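(* Let $n\geq 1$ and let $\Theta=(\theta_{p,q})_{1\leq p,q\leq n}$ be a real skew-symmetric matrix. If $\mathcal{P}\in P(C_{\mathrm{alg}}(\mathbb{R}_{\Theta}^{2n}))$, then $\mathcal{P}\in P(\mathbb{C})$; that is, every projector of $C_{\mathrm{alg}}(\mathbb{R}_{\Theta}^{2n})$ has all its entries in $\mathbb{C}$.
   Context: Put $\lambda_{p,q}:=e^{i\theta_{p,q}}$ with $\theta_{p,q}=-\theta_{q,p}\in\mathbb{R}$. $C_{\mathrm{alg}}(\mathbb{R}_{\Theta}^{2n})$ is the complex unital associative $*$-algebra generated by $2n$ elements $z_p,\bar z_q$ ($p,q=1,\ldots,n$) with relations $$z_pz_q=\lambda_{p,q}z_qz_p,\quad \bar z_p\bar z_q=\lambda_{p,q}\bar z_q\bar z_p,\quad \bar z_pz_q=\lambda_{q,p}z_q\bar z_p,\quad z_p^*=\bar z_p\qquad (p,q=1,\ldots,n).$$ For a unital $*$-algebra $A$, a projector of $A$ is a square matrix $p$ (of any size) with entries in $A$ such that $p^2=p=p^*$, where $(p^* )_{k,l}=(p_{l,k})^*$; $P(A)$ denotes the set of projectors of $A$. $\mathbb{C}$ is regarded as the subalgebra $\mathbb{C}\cdot 1$ of $C_{\mathrm{alg}}(\mathbb{R}_{\Theta}^{2n})$, so that $P(\mathbb{C})\subseteq P(C_{\mathrm{alg}}(\mathbb{R}_{\Theta}^{2n}))$. *)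

theory Defs
  imports
    "HOL-Algebra.QuotRing"
    "HOL-Library.Poly_Mapping"
    "Jordan_Normal_Form.Matrix"
begin

section \<open>Star-algebras and their projectors\<close>

text \<open>
  The record only carries the operations of a complex unital \<open>*\<close>-algebra, not its axioms.  The entries
  of \<^typ>\<open>'a mat\<close> are multiplied with the operations of the record, so the matrix product of
  \<open>Jordan_Normal_Form\<close>, which belongs to a type class, does not apply.
\<close>

record 'a star_algebra = "(complex, 'a) module" +
  star :: "'a \<Rightarrow> 'a"

definition mat_prod :: "('a, 'm) ring_scheme \<Rightarrow> 'a mat \<Rightarrow> 'a mat \<Rightarrow> 'a mat" where
  "mat_prod A P Q = mat (dim_row P) (dim_col Q)
     (\<lambda>(k, l). \<Oplus>\<^bsub>A\<^esub>j\<in>{..<dim_col P}. P $$ (k, j) \<otimes>\<^bsub>A\<^esub> Q $$ (j, l))"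

definition mat_star :: "('a, 'm) star_algebra_scheme \<Rightarrow> 'a mat \<Rightarrow> 'a mat" where
  "mat_star A P = mat (dim_col P) (dim_row P) (\<lambda>(k, l). star A (P $$ (l, k)))"

definition projectors :: "('a, 'm) star_algebra_scheme \<Rightarrow> 'a mat set" where
  "projectors A = {P. square_mat P \<and> elements_mat P \<subseteq> carrier A \<and>
     mat_prod A P P = P \<and> mat_star A P = P}"

definition scalar_subalgebra :: "('a, 'm) star_algebra_scheme \<Rightarrow> ('a, 'm) star_algebra_scheme" where
  "scalar_subalgebra A = A\<lparr>carrier := {c \<odot>\<^bsub>A\<^esub> \<one>\<^bsub>A\<^esub> | c. True}\<rparr>"

text \<open>
  The operations of a quotient act on cosets: the sum with \<open>I\<close> in \<^const>\<open>smult\<close> is only needed for the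
  scalar \<open>0\<close>, where the pointwise multiple of a coset is not a coset.  The involution is well
  defined as soon as \<open>I\<close> is closed under the involution.
\<close>

definition star_quot :: "('a, 'm) star_algebra_scheme \<Rightarrow> 'a set \<Rightarrow> 'a set star_algebra" where
  "star_quot A I =
    \<lparr>carrier = carrier (A Quot I), monoid.mult = monoid.mult (A Quot I), one = one (A Quot I),
     ring.zero = ring.zero (A Quot I), ring.add = ring.add (A Quot I),
     smult = (\<lambda>c X. I <+>\<^bsub>A\<^esub> (smult A c ` X)),
     star = (\<lambda>X. star A ` X)\<rparr>"


section \<open>The free star-algebra on the coordinates\<close>

text \<open>Words form a monoid under concatenation, written additively as \<^theory>\<open>HOL-Library.Poly_Mapping\<close>
  requires; so \<open>'a list \<Rightarrow>\<^sub>0 complex\<close> is the free unital associative algebra on \<open>'a\<close>.\<close>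

instantiation list :: (type) monoid_add
begin

definition zero_list :: "'a list" where "zero_list = []"
definition plus_list :: "'a list \<Rightarrow> 'a list \<Rightarrow> 'a list" where "plus_list = (@)"

instance
  by standard (simp_all add: zero_list_def plus_list_def)

end

datatype 'n coord = Z 'n | Zbar 'n

fun conj_coord :: "'n coord \<Rightarrow> 'n coord" where
  "conj_coord (Z p) = Zbar p"
| "conj_coord (Zbar p) = Z p"

type_synonym 'n free = "'n coord list \<Rightarrow>\<^sub>0 complex"

abbreviation monom_word :: "'n coord list \<Rightarrow> complex \<Rightarrow> 'n free" where
  "monom_word \<equiv> Poly_Mapping.single"

text \<open>The conjugate-linear anti-automorphism exchanging \<open>Z p\<close> and \<open>Zbar p\<close>.\<close>

definition free_star :: "'n free \<Rightarrow> 'n free" where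
  "free_star f = (\<Sum>w\<in>Poly_Mapping.keys f.
     monom_word (rev (map conj_coord w)) (cnj (Poly_Mapping.lookup f w)))"

definition free_alg :: "'n free star_algebra" where
  "free_alg = \<lparr>carrier = UNIV, monoid.mult = (*), one = 1, ring.zero = 0, ring.add = (+),
     smult = (\<lambda>c f. monom_word [] c * f), star = free_star\<rparr>"


section \<open>The noncommutative Euclidean space\<close>

definition gen_z :: "'n \<Rightarrow> 'n free" where
  "gen_z p = monom_word [Z p] 1"

definition gen_zbar :: "'n \<Rightarrow> 'n free" where
  "gen_zbar p = monom_word [Zbar p] 1"

definition lam :: "('n \<Rightarrow> 'n \<Rightarrow> real) \<Rightarrow> 'n \<Rightarrow> 'n \<Rightarrow> complex" where
  "lam \<Theta> p q = cis (\<Theta> p q)"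

definition relators :: "('n \<Rightarrow> 'n \<Rightarrow> real) \<Rightarrow> 'n free set" where
  "relators \<Theta> =
     {gen_z p * gen_z q - monom_word [] (lam \<Theta> p q) * (gen_z q * gen_z p) | p q. True} \<union>
     {gen_zbar p * gen_zbar q - monom_word [] (lam \<Theta> p q) * (gen_zbar q * gen_zbar p) | p q. True} \<union>
     {gen_zbar p * gen_z q - monom_word [] (lam \<Theta> q p) * (gen_z q * gen_zbar p) | p q. True}"

definition C_alg :: "('n \<Rightarrow> 'n \<Rightarrow> real) \<Rightarrow> 'n free set star_algebra" where
  "C_alg \<Theta> = star_quot free_alg (Idl\<^bsub>free_alg\<^esub> (relators \<Theta>))"

end

theory Submission
  imports Defs "HOL-Library.Multiset"
begin

text \<open>
  Every relation has the form \<open>a b = e\<^sup>i\<^sup>t b a\<close> for coordinates \<open>a\<close>, \<open>b\<close> and a real number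
  \<open>t = twist a b\<close>, where \<open>twist\<close> is skew-symmetric and changes sign when one of its arguments is
  conjugated.  Weyl ordering divides a word \<open>x\<^sub>1 \<dots> x\<^sub>k\<close> by the phase with exponent
  \<open>1/2 \<Sum>\<^sub>i\<^sub><\<^sub>j twist x\<^sub>i x\<^sub>j\<close>.  The result depends only on the multiset of letters, so the algebra is a
  twisted version of the monoid algebra of the multisets of coordinates: the product of the basis
  elements of \<open>A\<close> and \<open>B\<close> is \<open>cis (cross A B / 2)\<close> times that of \<open>A + B\<close>, and the involution replaces
  the basis element of \<open>A\<close> by that of the conjugate multiset \<open>A\<^sup>*\<close>, without a phase (\<open>coef_mult\<close>,
  \<open>coef_free_star\<close>).  That nothing more is identified is seen from the coefficients \<open>coef M\<close>, which
  vanish on the ideal of relations (\<open>coef_rel_ideal\<close>); that nothing less is, from \<open>weyl_cong_mset\<close>,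
  which permutes the letters of a word modulo the ideal.

  In this basis a projector \<open>p = p\<^sup>* = p\<^sup>2\<close> is seen to be scalar by positivity
  (\<open>twisted_projector_scalar\<close>).  Suppose that a multiset other than \<open>{#}\<close> occurs in some entry.
  Among the multisets that occur, let \<open>M\<close> maximise the Euclidean norm of \<open>T = M + M\<^sup>*\<close>, seen as a vector
  of multiplicities.  In row \<open>k\<close> of an entry that contains \<open>M\<close>, compare the coefficients at \<open>T\<close> in
  \<open>\<Sum>\<^sub>j p\<^sub>k\<^sub>j p\<^sub>k\<^sub>j\<^sup>* = p\<^sub>k\<^sub>k\<close>.  On the left, a product of the terms of \<open>A\<close> and \<open>B\<^sup>*\<close> contributes only if
  \<open>A + B\<^sup>* = T\<close>; then \<open>A + A\<^sup>*\<close> and \<open>B + B\<^sup>*\<close> have midpoint \<open>T\<close> and are not longer than \<open>T\<close>, so both are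
  equal to \<open>T\<close>, because a ball is strictly convex.  Cancellation gives \<open>A = B\<close>.  The phase of
  \<open>A\<close> against \<open>A\<^sup>*\<close> is trivial, so the left-hand side is a sum of squares \<open>|p\<^sub>k\<^sub>j(A)|\<^sup>2\<close>, one of which is
  positive.  The right-hand side is zero, because \<open>T + T\<^sup>* = 2 T\<close> is longer than \<open>T\<close> and so \<open>T\<close> does
  not occur in any entry.
\<close>

section \<open>Coordinates and words\<close>

lemma conj_coord_conj_coord [simp]: "conj_coord (conj_coord a) = a"
  by (cases a) auto

fun coord_index :: "'n coord \<Rightarrow> 'n" where
  "coord_index (Z p) = p"
| "coord_index (Zbar p) = p"

fun coord_sign :: "'n coord \<Rightarrow> real" where
  "coord_sign (Z p) = 1"
| "coord_sign (Zbar p) = -1"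

lemma sum_mset_uminus: "(\<Sum>a\<in>#A. - f a) = - (\<Sum>a\<in>#A. f a)" for f :: "'a \<Rightarrow> real"
  by (induction A) auto

lemma finite_subset_mset: "finite {A. A \<subseteq># M}"
proof (induction M)
  case (add x M)
  have "{A. A \<subseteq># add_mset x M} \<subseteq> {A. A \<subseteq># M} \<union> add_mset x ` {A. A \<subseteq># M}"
  proof
    fix A assume "A \<in> {A. A \<subseteq># add_mset x M}"
    then have A: "A \<subseteq># add_mset x M" by simp
    show "A \<in> {A. A \<subseteq># M} \<union> add_mset x ` {A. A \<subseteq># M}"
    proof (cases "x \<in># A")
      case True
      then obtain B where "A = add_mset x B" by (metis insert_DiffM)
      with A show ?thesis by auto
    next
      case False
      with A have "A \<subseteq># M"
        by (metis diff_single_trivial subset_eq_diff_conv add_mset_remove_trivial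
            union_mset_add_mset_right add.right_neutral)
      then show ?thesis by simp
    qed
  qed
  with add show ?case by (meson finite_UnI finite_imageI finite_subset)
qed simp

lemma free_eq_sum: "f = (\<Sum>w\<in>Poly_Mapping.keys f. monom_word w (Poly_Mapping.lookup f w))"
  for f :: "'n free"
proof (rule poly_mapping_eqI)
  fix u
  show "Poly_Mapping.lookup f u
    = Poly_Mapping.lookup (\<Sum>w\<in>Poly_Mapping.keys f. monom_word w (Poly_Mapping.lookup f w)) u"
    by (simp add: lookup_sum lookup_single when_def in_keys_iff)
qed

lemma free_alg_ring: "ring (free_alg :: 'n free star_algebra)"
proof (rule ringI)
  show "abelian_group (free_alg :: 'n free star_algebra)"
    by (rule abelian_groupI) (auto simp: free_alg_def add_ac intro: exI[of _ "- _"])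
  show "Group.monoid (free_alg :: 'n free star_algebra)"
    by (rule monoidI) (auto simp: free_alg_def mult.assoc)
qed (auto simp: free_alg_def distrib_left distrib_right)

section \<open>Weyl ordering\<close>

locale skew_form =
  fixes \<Theta> :: "'n \<Rightarrow> 'n \<Rightarrow> real"
  assumes skew: "\<Theta> p q = - \<Theta> q p"
begin

text \<open>
  The product of the signs is \<open>-1\<close> if exactly one of \<open>a\<close>, \<open>b\<close> is a conjugate.  So the three kinds of
  relators become the one rule \<open>a b = cis (twist a b) b a\<close>.
\<close>

definition twist :: "'n coord \<Rightarrow> 'n coord \<Rightarrow> real" where
  "twist a b = coord_sign a * coord_sign b * \<Theta> (coord_index a) (coord_index b)"

definition cross :: "'n coord multiset \<Rightarrow> 'n coord multiset \<Rightarrow> real" where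
  "cross A B = (\<Sum>a\<in>#A. \<Sum>b\<in>#B. twist a b)"

text \<open>
  Half the sum of the twists over all pairs of positions \<open>i < j\<close> of the word: the exponent in Weyl
  ordering.
\<close>

fun word_phase :: "'n coord list \<Rightarrow> real" where
  "word_phase [] = 0"
| "word_phase (a # w) = cross {#a#} (mset w) / 2 + word_phase w"

lemma twist_skew:
  "twist a b = - twist b a"
  using skew[of "coord_index a" "coord_index b"] by (simp add: twist_def)

lemma twist_conj_right [simp]: "twist a (conj_coord b) = - twist a b"
  by (cases b) (simp_all add: twist_def)

lemma twist_conj_left [simp]: "twist (conj_coord a) b = - twist a b"
  by (cases a) (simp_all add: twist_def)

lemma cross_add_left: "cross (A + B) C = cross A C + cross B C"
  by (simp add: cross_def)

lemma cross_add_right: "cross A (B + C) = cross A B + cross A C"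
  by (simp add: cross_def sum_mset.distrib)

lemma cross_empty [simp]: "cross {#} A = 0" "cross A {#} = 0"
  by (simp_all add: cross_def)

lemma cross_skew:
  "cross A B = - cross B A"
proof -
  have "cross A B = (\<Sum>a\<in>#A. \<Sum>b\<in>#B. - twist b a)"
    unfolding cross_def
    by (intro arg_cong[where f = sum_mset] image_mset_cong twist_skew)
  also have "\<dots> = (\<Sum>b\<in>#B. \<Sum>a\<in>#A. - twist b a)"
    by (rule sum_mset.swap)
  finally show ?thesis by (simp add: cross_def sum_mset_uminus)
qed

lemma cross_conj [simp]:
  "cross (image_mset conj_coord A) B = - cross A B"
  "cross A (image_mset conj_coord B) = - cross A B"
  by (simp_all add: cross_def image_mset.compositionality o_def sum_mset_uminus
      ext[OF twist_conj_left])

text \<open>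
  This is why \<open>f f\<^sup>*\<close> has squared moduli among its coefficients.
\<close>

lemma cross_conj_self:
  "cross A (image_mset conj_coord A) = 0"
proof -
  have "cross A A = - cross A A"
    by (rule cross_skew)
  then show ?thesis by (simp only: cross_conj)
qed

lemma word_phase_append:
  "word_phase (u @ v) = word_phase u + word_phase v + cross (mset u) (mset v) / 2"
proof (induction u)
  case (Cons a u)
  have "cross (add_mset a (mset u)) (mset v) = cross {#a#} (mset v) + cross (mset u) (mset v)"
    using cross_add_left[of "{#a#}" "mset u" "mset v"] by simp
  with Cons show ?case by (simp add: cross_add_right add_divide_distrib)
qed simp

text \<open>
  Reversing a word negates its phase, by skewness, and conjugating all letters does not change it,
  because every pair of letters changes sign twice.  So the involution preserves Weyl ordering.
\<close>

lemma word_phase_conj: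
  "word_phase (rev (map conj_coord w)) = - word_phase w"
proof (induction w)
  case (Cons a w)
  have mset: "mset (rev (map conj_coord w)) = image_mset conj_coord (mset w)"
    "mset [conj_coord a] = image_mset conj_coord {#a#}" by simp_all
  have "word_phase (rev (map conj_coord (a # w))) =
      - word_phase w + cross (mset w) {#a#} / 2"
    unfolding list.map rev.simps word_phase_append mset cross_conj Cons.IH by simp
  also have "cross (mset w) {#a#} = - cross {#a#} (mset w)"
    by (rule cross_skew)
  finally show ?case by simp
qed simp

text \<open>
  Half of \<open>twist a b\<close> becomes half of \<open>twist b a = - twist a b\<close>, so the exchange of neighbours changes
  the phase as the relations require.
\<close>

lemma word_phase_swap:
  "word_phase (a # b # w) = word_phase (b # a # w) + twist a b"
proof -
  have *: "cross {#c#} (add_mset d D) = twist c d + cross {#c#} D" for c d D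
    by (simp add: cross_def)
  show ?thesis
    using twist_skew[where a = a and b = b] by (simp add: * add_divide_distrib diff_divide_distrib)
qed

definition word_weight :: "'n coord multiset \<Rightarrow> 'n coord list \<Rightarrow> complex" where
  "word_weight M w = (if mset w = M then cis (word_phase w) else 0)"

text \<open>
  The coefficient of \<open>f\<close> at the Weyl-ordered monomial of \<open>M\<close>, read off from a representative in the
  free algebra.
\<close>

definition coef :: "'n coord multiset \<Rightarrow> 'n free \<Rightarrow> complex" where
  "coef M f = (\<Sum>w\<in>Poly_Mapping.keys f. Poly_Mapping.lookup f w * word_weight M w)"

lemma coef_superset:
  assumes "finite S" "Poly_Mapping.keys f \<subseteq> S"
  shows "coef M f = (\<Sum>w\<in>S. Poly_Mapping.lookup f w * word_weight M w)"
  unfolding coef_def using assms by (intro sum.mono_neutral_left) (auto simp: in_keys_iff)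

lemma coef_zero [simp]: "coef M 0 = 0"
  by (simp add: coef_def)

lemma coef_add: "coef M (f + g) = coef M f + coef M g"
proof -
  let ?S = "Poly_Mapping.keys f \<union> Poly_Mapping.keys g"
  have "coef M h = (\<Sum>w\<in>?S. Poly_Mapping.lookup h w * word_weight M w)"
    if "h \<in> {f, g, f + g}" for h
    using that Poly_Mapping.keys_add[of f g] by (intro coef_superset) auto
  then show ?thesis by (simp add: lookup_add distrib_right sum.distrib)
qed

lemma coef_uminus: "coef M (- f) = - coef M f"
  using coef_add[of M f "- f"] by (simp add: eq_neg_iff_add_eq_0 add.commute)

lemma coef_diff: "coef M (f - g) = coef M f - coef M g"
  using coef_add[of M f "- g"] by (simp add: coef_uminus)

lemma coef_sum: "coef M (\<Sum>i\<in>S. f i) = (\<Sum>i\<in>S. coef M (f i))"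
  by (induction S rule: infinite_finite_induct) (auto simp: coef_add)

lemma coef_single [simp]: "coef M (monom_word w c) = c * word_weight M w"
  by (simp add: coef_def)

text \<open>
  The product of the twisted monoid algebra of multisets, on coefficient functions.
\<close>

definition twisted_conv ::
  "('n coord multiset \<Rightarrow> complex) \<Rightarrow> ('n coord multiset \<Rightarrow> complex) \<Rightarrow>
    'n coord multiset \<Rightarrow> complex" where
  "twisted_conv a b M = (\<Sum>A | A \<subseteq># M. cis (cross A (M - A) / 2) * (a A * b (M - A)))"

text \<open>
  Both sides are bilinear, and for words \<open>u\<close> and \<open>v\<close> the identity is \<open>word_phase_append\<close>: the only
  splitting of \<open>M\<close> that contributes is \<open>mset u + mset v\<close>.
\<close>

lemma coef_mult: "coef M (f * g) = twisted_conv (\<lambda>A. coef A f) (\<lambda>B. coef B g) M"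
proof -
  let ?f = "Poly_Mapping.lookup f" and ?g = "Poly_Mapping.lookup g"
  have weight: "word_weight M (u + v) =
      (\<Sum>A | A \<subseteq># M. cis (cross A (M - A) / 2) * (word_weight A u * word_weight (M - A) v))"
    (is "_ = (\<Sum>A | A \<subseteq># M. ?t A)") for u v
  proof -
    have "(\<Sum>A | A \<subseteq># M. ?t A) = (\<Sum>A\<in>{A. A \<subseteq># M} \<inter> {mset u}. ?t A)"
      by (rule sum.mono_neutral_right) (auto simp: finite_subset_mset word_weight_def)
    also have "\<dots> = word_weight M (u + v)"
    proof (cases "mset u \<subseteq># M")
      case True
      then have "mset u + mset v = M \<longleftrightarrow> mset v = M - mset u" by auto
      with True show ?thesis
        by (auto simp: word_weight_def plus_list_def word_phase_append cis_mult algebra_simps)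
    next
      case False
      then have "mset u + mset v \<noteq> M" by auto
      with False show ?thesis by (simp add: word_weight_def plus_list_def)
    qed
    finally show ?thesis by simp
  qed
  have "f * g = (\<Sum>u\<in>Poly_Mapping.keys f. \<Sum>v\<in>Poly_Mapping.keys g. monom_word (u + v) (?f u * ?g v))"
    using arg_cong2[OF free_eq_sum[of f] free_eq_sum[of g], of times]
    unfolding sum_product mult_single .
  then have "coef M (f * g) =
      (\<Sum>u\<in>Poly_Mapping.keys f. \<Sum>v\<in>Poly_Mapping.keys g. \<Sum>A | A \<subseteq># M.
        cis (cross A (M - A) / 2) * ((?f u * word_weight A u) * (?g v * word_weight (M - A) v)))"
    by (simp add: coef_sum weight sum_distrib_left mult_ac)
  also have "\<dots> = (\<Sum>u\<in>Poly_Mapping.keys f. \<Sum>A | A \<subseteq># M. \<Sum>v\<in>Poly_Mapping.keys g.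
        cis (cross A (M - A) / 2) * ((?f u * word_weight A u) * (?g v * word_weight (M - A) v)))"
    by (intro sum.cong refl sum.swap)
  also have "\<dots> = (\<Sum>A | A \<subseteq># M. \<Sum>u\<in>Poly_Mapping.keys f. \<Sum>v\<in>Poly_Mapping.keys g.
        cis (cross A (M - A) / 2) * ((?f u * word_weight A u) * (?g v * word_weight (M - A) v)))"
    by (rule sum.swap)
  also have "\<dots> = twisted_conv (\<lambda>A. coef A f) (\<lambda>B. coef B g) M"
    unfolding twisted_conv_def coef_def sum_product by (simp add: sum_distrib_left)
  finally show ?thesis .
qed

lemma coef_free_star:
  "coef M (free_star f) = cnj (coef (image_mset conj_coord M) f)"
proof -
  have eq: "image_mset conj_coord A = B \<longleftrightarrow> A = image_mset conj_coord B"
    for A B :: "'a coord multiset"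
    by (auto simp: image_mset.compositionality o_def)
  have "word_weight M (rev (map conj_coord w)) = cnj (word_weight (image_mset conj_coord M) w)" for w
    by (simp add: word_weight_def word_phase_conj cis_cnj eq)
  then show ?thesis
    unfolding free_star_def coef_sum coef_def[of _ f] by simp
qed

section \<open>The quotient by the relations in the Weyl basis\<close>

definition rel_ideal :: "'n free set" where
  "rel_ideal = Idl\<^bsub>free_alg\<^esub> (relators \<Theta>)"

lemma rel_ideal_ideal: "ideal rel_ideal free_alg"
  unfolding rel_ideal_def by (rule ring.genideal_ideal[OF free_alg_ring]) (simp add: free_alg_def)

lemma rel_ideal_add: "f \<in> rel_ideal \<Longrightarrow> g \<in> rel_ideal \<Longrightarrow> f + g \<in> rel_ideal"
  using additive_subgroup.a_closed[OF ideal.axioms(1)[OF rel_ideal_ideal], of f g]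
  by (simp add: free_alg_def)

lemma rel_ideal_zero: "0 \<in> rel_ideal"
  using additive_subgroup.zero_closed[OF ideal.axioms(1)[OF rel_ideal_ideal]]
  by (simp add: free_alg_def)

lemma rel_ideal_mult_left: "f \<in> rel_ideal \<Longrightarrow> g * f \<in> rel_ideal"
  using ideal.I_l_closed[OF rel_ideal_ideal, of f g] by (simp add: free_alg_def)

lemma rel_ideal_mult_right: "f \<in> rel_ideal \<Longrightarrow> f * g \<in> rel_ideal"
  using ideal.I_r_closed[OF rel_ideal_ideal, of f g] by (simp add: free_alg_def)

lemma rel_ideal_uminus: "f \<in> rel_ideal \<Longrightarrow> - f \<in> rel_ideal"
  using rel_ideal_mult_left[of f "- 1"] by simp

lemma rel_ideal_sum: "(\<And>i. i \<in> S \<Longrightarrow> f i \<in> rel_ideal) \<Longrightarrow> sum f S \<in> rel_ideal"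
  by (induction S rule: infinite_finite_induct) (auto intro: rel_ideal_add rel_ideal_zero)

lemma coef_relator:
  assumes "r \<in> relators \<Theta>"
  shows "coef M r = 0"
proof -
  have half: "cis (t / 2) = cis t * cis (- t / 2)" for t
    by (simp add: cis_mult)
  have commutator: "coef M (monom_word [a] 1 * monom_word [b] 1
      - monom_word [] (cis (twist a b)) * (monom_word [b] 1 * monom_word [a] 1)) = 0" for a b
  proof -
    have "cross {#a#} {#b#} = twist a b" "cross {#b#} {#a#} = - twist a b"
      using twist_skew[of b a] by (simp_all add: cross_def)
    then show ?thesis
      using half[of "twist a b"]
      by (simp add: coef_diff mult_single plus_list_def word_weight_def add_mset_commute)
  qed
  have "twist (Z p) (Z q) = \<Theta> p q" "twist (Zbar p) (Zbar q) = \<Theta> p q"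
    "twist (Zbar p) (Z q) = \<Theta> q p" for p q
    using skew[of q p] by (simp_all add: twist_def)
  then show ?thesis
    using assms commutator[of "Z _" "Z _"] commutator[of "Zbar _" "Zbar _"]
      commutator[of "Zbar _" "Z _"]
    by (auto simp: relators_def gen_z_def gen_zbar_def lam_def)
qed

text \<open>
  The elements all of whose coefficients vanish form a two-sided ideal, by \<open>coef_mult\<close>, and this ideal
  contains the relators.
\<close>

lemma coef_rel_ideal:
  assumes "f \<in> rel_ideal"
  shows "coef M f = 0"
proof -
  let ?K = "{f. \<forall>M. coef M f = 0}"
  have "subgroup ?K (add_monoid free_alg)"
  proof (rule group.subgroupI)
    show "group (add_monoid free_alg)"
      using ring.is_abelian_group[OF free_alg_ring] abelian_group.a_group by blast
    show "inv\<^bsub>add_monoid free_alg\<^esub> g \<in> ?K" if "g \<in> ?K" for g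
    proof -
      have "inv\<^bsub>add_monoid free_alg\<^esub> g = - g"
        using abelian_group.minus_equality[OF ring.is_abelian_group[OF free_alg_ring], of "- g" g]
        by (simp add: free_alg_def a_inv_def)
      with that show ?thesis by (simp add: coef_uminus)
    qed
  qed (auto simp: free_alg_def coef_add intro: exI[of _ 0])
  then have "ideal ?K free_alg"
    by (intro idealI free_alg_ring) (auto simp: free_alg_def coef_mult twisted_conv_def)
  moreover have "relators \<Theta> \<subseteq> ?K"
    using coef_relator by blast
  ultimately have "rel_ideal \<subseteq> ?K"
    unfolding rel_ideal_def by (rule ring.genideal_minimal[OF free_alg_ring])
  with assms show ?thesis by blast
qed

definition weyl :: "'n coord list \<Rightarrow> 'n free" where
  "weyl w = monom_word w (cis (- word_phase w))"

text \<open>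
  The relators cover three of the four kinds of pairs.  For \<open>z\<^sub>p\<close> and \<open>zbar\<^sub>q\<close> the relator of
  \<open>zbar\<^sub>q\<close> and \<open>z\<^sub>p\<close>, solved for the other product, gives the commutator.
\<close>

lemma commutator_in_rel_ideal:
  "monom_word [a, b] 1 - monom_word [b, a] (cis (twist a b)) \<in> rel_ideal"
proof -
  have relator: "r \<in> relators \<Theta> \<Longrightarrow> r \<in> rel_ideal" for r
    using ring.genideal_self[OF free_alg_ring, of "relators \<Theta>"]
    by (auto simp: rel_ideal_def free_alg_def)
  note simps = gen_z_def gen_zbar_def lam_def mult_single plus_list_def twist_def
  show ?thesis
  proof (cases a; cases b)
    fix p q assume "a = Z p" "b = Z q"
    moreover have "gen_z p * gen_z q - monom_word [] (lam \<Theta> p q) * (gen_z q * gen_z p) \<in> rel_ideal"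
      by (rule relator) (auto simp: relators_def)
    ultimately show ?thesis by (simp add: simps)
  next
    fix p q assume "a = Zbar p" "b = Zbar q"
    moreover have "gen_zbar p * gen_zbar q - monom_word [] (lam \<Theta> p q) * (gen_zbar q * gen_zbar p) \<in> rel_ideal"
      by (rule relator) (auto simp: relators_def)
    ultimately show ?thesis by (simp add: simps)
  next
    fix p q assume "a = Zbar p" "b = Z q"
    moreover have "gen_zbar p * gen_z q - monom_word [] (lam \<Theta> q p) * (gen_z q * gen_zbar p) \<in> rel_ideal"
      by (rule relator) (auto simp: relators_def)
    ultimately show ?thesis using skew[of q p] by (simp add: simps)
  next
    fix p q assume "a = Z p" "b = Zbar q"
    moreover have "monom_word [] (- cis (- \<Theta> p q)) *
        (gen_zbar q * gen_z p - monom_word [] (lam \<Theta> p q) * (gen_z p * gen_zbar q)) \<in> rel_ideal"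
      by (rule rel_ideal_mult_left, rule relator) (auto simp: relators_def)
    ultimately show ?thesis
      by (simp add: simps right_diff_distrib cis_mult single_uminus)
  qed
qed

lemma weyl_swap: "weyl (a # b # w) - weyl (b # a # w) \<in> rel_ideal"
proof -
  let ?c = "cis (- word_phase (a # b # w))"
  have phase: "cis (twist a b) * ?c = cis (- word_phase (b # a # w))"
    unfolding cis_mult word_phase_swap[of a b w] by (simp del: word_phase.simps)
  have "(monom_word [a, b] 1 - monom_word [b, a] (cis (twist a b))) * monom_word w ?c \<in> rel_ideal"
    by (intro rel_ideal_mult_right commutator_in_rel_ideal)
  then show ?thesis
    unfolding left_diff_distrib mult_single phase
    by (simp add: weyl_def plus_list_def del: word_phase.simps)
qed

lemma weyl_Cons:
  "weyl (a # w) = monom_word [a] (cis (- cross {#a#} (mset w) / 2)) * weyl w"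
  by (simp add: weyl_def mult_single plus_list_def cis_mult add.commute)

lemma weyl_Cons_cong:
  assumes "weyl u - weyl v \<in> rel_ideal" "mset u = mset v"
  shows "weyl (a # u) - weyl (a # v) \<in> rel_ideal"
  using rel_ideal_mult_left[OF assms(1)] by (simp add: weyl_Cons assms(2) right_diff_distrib)

lemma rel_ideal_trans:
  "f - g \<in> rel_ideal \<Longrightarrow> g - h \<in> rel_ideal \<Longrightarrow> f - h \<in> rel_ideal"
  using rel_ideal_add[of "f - g" "g - h"] by simp

lemma weyl_move_front: "weyl (a # u @ v) - weyl (u @ a # v) \<in> rel_ideal"
proof (induction u)
  case (Cons b u)
  have "weyl (b # a # u @ v) - weyl (b # u @ a # v) \<in> rel_ideal"
    by (rule weyl_Cons_cong[OF Cons]) simp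
  then show ?case using rel_ideal_trans[OF weyl_swap] by simp
qed (simp add: rel_ideal_zero)

text \<open>
  The Weyl-ordered monomial of a multiset is well defined in the quotient: a letter is moved to the
  front by exchanges of neighbours, and the rest follows by induction.
\<close>

lemma weyl_cong_mset: "mset u = mset v \<Longrightarrow> weyl u - weyl v \<in> rel_ideal"
proof (induction u arbitrary: v)
  case (Cons a u)
  then have "a \<in> set v" by (metis list.set_intros(1) mset_eq_setD)
  then obtain v1 v2 where v: "v = v1 @ a # v2" by (meson split_list)
  with Cons have mset: "mset u = mset (v1 @ v2)" by simp
  show ?case
    unfolding v using rel_ideal_trans[OF weyl_Cons_cong[OF Cons.IH[OF mset] mset] weyl_move_front] .
qed (simp add: rel_ideal_zero)

text \<open>
  Converse to \<open>coef_rel_ideal\<close>, up to scalars: modulo the ideal, \<open>f\<close> is the sum of its Weyl-ordered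
  monomials with the coefficients \<open>coef M f\<close>, and only the empty multiset is left.
\<close>

lemma scalar_if_coef_zero:
  assumes zero: "\<And>M. M \<noteq> {#} \<Longrightarrow> coef M f = 0"
  shows "f - monom_word [] (coef {#} f) \<in> rel_ideal"
proof -
  let ?K = "Poly_Mapping.keys f"
  let ?c = "\<lambda>w. Poly_Mapping.lookup f w * cis (word_phase w)"
  \<comment> \<open>A standard word for each multiset, to which all its words are brought.\<close>
  obtain std :: "'n coord multiset \<Rightarrow> 'n coord list" where std: "mset (std M) = M" for M
    using ex_mset by metis
  have sum_single: "(\<Sum>i\<in>S. monom_word u (g i)) = monom_word u (\<Sum>i\<in>S. g i)"
    for S :: "'n coord list set" and u :: "'n coord list" and g :: "'n coord list \<Rightarrow> complex"
    by (induction S rule: infinite_finite_induct) (auto simp: single_add)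
  have coef: "coef M f = (\<Sum>w\<in>{w\<in>?K. mset w = M}. ?c w)" for M
    unfolding coef_def by (rule sum.mono_neutral_cong_right) (auto simp: word_weight_def)
  have "f - (\<Sum>w\<in>?K. monom_word [] (?c w) * weyl (std (mset w)))
      = (\<Sum>w\<in>?K. monom_word [] (?c w) * (weyl w - weyl (std (mset w))))"
  proof -
    have "monom_word [] (?c w) * weyl w = monom_word w (Poly_Mapping.lookup f w)" for w
      by (simp add: weyl_def mult_single plus_list_def mult.assoc cis_mult)
    then show ?thesis
      using free_eq_sum[of f] by (simp add: right_diff_distrib sum_subtractf)
  qed
  also have "\<dots> \<in> rel_ideal"
    by (intro rel_ideal_sum rel_ideal_mult_left weyl_cong_mset) (simp add: std)
  finally have in_ideal: "f - (\<Sum>w\<in>?K. monom_word [] (?c w) * weyl (std (mset w))) \<in> rel_ideal" .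
  let ?T = "insert {#} (mset ` ?K)"
  have "(\<Sum>w\<in>?K. monom_word [] (?c w) * weyl (std (mset w)))
      = (\<Sum>M\<in>?T. \<Sum>w\<in>{w\<in>?K. mset w = M}. monom_word [] (?c w) * weyl (std (mset w)))"
    by (rule sum.group[symmetric]) auto
  also have "\<dots> = (\<Sum>M\<in>?T. monom_word [] (coef M f) * weyl (std M))"
    by (intro sum.cong refl) (simp add: coef sum_single[symmetric] sum_distrib_right)
  also have "\<dots> = (\<Sum>M\<in>{{#}}. monom_word [] (coef M f) * weyl (std M))"
    by (rule sum.mono_neutral_right) (auto simp: zero)
  also have "\<dots> = monom_word [] (coef {#} f)"
    using std[of "{#}"] by (simp add: weyl_def mult_single plus_list_def)
  finally show ?thesis using in_ideal by simp
qed

end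

section \<open>Positivity\<close>

text \<open>
  Strict convexity of the ball: if neither end of a segment is longer than its midpoint, the segment
  is a point.  This is the parallelogram identity.
\<close>

lemma midpoint_of_ball_unique:
  fixes a b t :: "'a \<Rightarrow> real"
  assumes "finite S" and "\<And>x. x \<in> S \<Longrightarrow> a x + b x = 2 * t x"
    and "(\<Sum>x\<in>S. (a x)\<^sup>2) \<le> (\<Sum>x\<in>S. (t x)\<^sup>2)" and "(\<Sum>x\<in>S. (b x)\<^sup>2) \<le> (\<Sum>x\<in>S. (t x)\<^sup>2)"
    and "x \<in> S"
  shows "a x = t x"
proof -
  have "2 * (a x - t x)\<^sup>2 = (a x)\<^sup>2 + (b x)\<^sup>2 - 2 * (t x)\<^sup>2" if "x \<in> S" for x
  proof -
    have b: "b x = 2 * t x - a x" using assms(2)[OF that] by simp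
    show ?thesis unfolding b by (simp add: power2_eq_square algebra_simps)
  qed
  then have "(\<Sum>x\<in>S. 2 * (a x - t x)\<^sup>2) = (\<Sum>x\<in>S. (a x)\<^sup>2 + (b x)\<^sup>2 - 2 * (t x)\<^sup>2)"
    by (intro sum.cong) auto
  also have "\<dots> \<le> 0"
    using assms(3,4) by (simp add: sum.distrib sum_subtractf sum_distrib_left[symmetric])
  finally have "(\<Sum>x\<in>S. 2 * (a x - t x)\<^sup>2) = 0"
    by (intro antisym sum_nonneg) auto
  then show ?thesis
    using assms(1,5) by (simp add: sum_nonneg_eq_0_iff)
qed

context skew_form
begin

text \<open>
  The matrix \<open>p\<close> is a projector over the twisted monoid algebra, given by coefficient functions.  A
  longest symmetrised multiset \<open>T\<close> of \<open>p\<close> has a positive sum of squared moduli as a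
  coefficient on the diagonal of \<open>p p\<^sup>*\<close>, while in \<open>p\<close> itself it does not occur.
\<close>

lemma twisted_projector_scalar:
  fixes p :: "nat \<Rightarrow> nat \<Rightarrow> 'n coord multiset \<Rightarrow> complex"
  assumes fin: "\<And>k l. finite {M. p k l M \<noteq> 0}"
    and star: "\<And>k l M. k < n \<Longrightarrow> l < n \<Longrightarrow> p k l M = cnj (p l k (image_mset conj_coord M))"
    and idem: "\<And>k l M. k < n \<Longrightarrow> l < n \<Longrightarrow> p k l M = (\<Sum>j<n. twisted_conv (p k j) (p j l) M)"
    and "k < n" "l < n" "M \<noteq> {#}"
  shows "p k l M = 0"
proof (rule ccontr)
  assume nonzero: "p k l M \<noteq> 0"
  define S where "S = (\<Union>k<n. \<Union>l<n. {M. p k l M \<noteq> 0})"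
  define sym where "sym M = M + image_mset conj_coord M" for M :: "'n coord multiset"
  define X where "X = (\<Union>M\<in>S. set_mset (sym M))"
  \<comment> \<open>The squared Euclidean norm of the symmetrised multiset; all the letters
    that occur in members of \<open>S\<close> or in their conjugates lie in the finite set \<open>X\<close>.\<close>
  define h where "h M = (\<Sum>x\<in>X. (real (count (sym M) x))\<^sup>2)" for M
  have conj_conj [simp]: "image_mset conj_coord (image_mset conj_coord A) = A" for A :: "'n coord multiset"
    by (simp add: image_mset.compositionality o_def)
  have "finite S" unfolding S_def using fin by simp
  then have "finite X" by (simp add: X_def)
  have "M \<in> S" using nonzero assms(4,5) by (auto simp: S_def)
  with \<open>finite S\<close> obtain M0 where M0: "M0 \<in> S" and max: "\<And>B. B \<in> S \<Longrightarrow> h B \<le> h M0"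
    using obtains_MAX[of S h] by (metis Max_ge empty_iff finite_imageI imageI)
  define T where "T = sym M0"
  have "h M0 > 0"
  proof -
    obtain x where "x \<in># M" using assms(6) by blast
    then have "0 < count (sym M) x" by (simp add: sym_def)
    then have "0 < (real (count (sym M) x))\<^sup>2" by simp
    also have "\<dots> \<le> h M"
      unfolding h_def using \<open>x \<in># M\<close> \<open>M \<in> S\<close> \<open>finite X\<close>
      by (intro member_le_sum) (auto simp: X_def sym_def)
    also have "\<dots> \<le> h M0" by (rule max[OF \<open>M \<in> S\<close>])
    finally show ?thesis .
  qed
  \<comment> \<open>As \<open>T\<close> is symmetric, its own symmetrisation doubles it, so \<open>T\<close> is too long to occur.\<close>
  have "sym T = T + T" by (simp add: T_def sym_def add_ac)
  then have "h T = 4 * h M0"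
    by (simp add: h_def T_def[symmetric] sum_distrib_left power2_eq_square algebra_simps)
  with \<open>h M0 > 0\<close> have "T \<notin> S" using max[of T] by fastforce
  obtain k0 l0 where k0: "k0 < n" and l0: "l0 < n" and p0: "p k0 l0 M0 \<noteq> 0"
    using M0 by (auto simp: S_def)
  let ?r = "\<lambda>j A. if T - A = image_mset conj_coord A then (cmod (p k0 j A))\<^sup>2 else 0"
  have summand: "cis (cross A (T - A) / 2) * (p k0 j A * p j k0 (T - A)) = of_real (?r j A)"
    if j: "j < n" and A: "A \<subseteq># T" for j A
  proof (cases "T - A = image_mset conj_coord A")
    case True
    have "p j k0 (T - A) = cnj (p k0 j A)"
      using star[OF j k0, of "T - A"] True by simp
    then show ?thesis
      using True cross_conj_self[of A]
      by (simp add: complex_norm_square[symmetric] del: of_real_power)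
  next
    case False
    define B where "B = image_mset conj_coord (T - A)"
    \<comment> \<open>The factor \<open>p j k0 (T - A)\<close> is conjugate to \<open>p k0 j B\<close>, and \<open>A\<close> and \<open>B\<close> can both occur only if
      their symmetrisations, whose midpoint is \<open>T\<close>, coincide with \<open>T\<close>.\<close>
    have "p k0 j A = 0 \<or> p k0 j B = 0"
    proof (rule ccontr)
      assume "\<not> ?thesis"
      then have "A \<in> S" "B \<in> S" using k0 j by (auto simp: S_def)
      have "T = A + (T - A)" using A by simp
      then have "sym T = A + (T - A) + image_mset conj_coord A + B"
        unfolding sym_def B_def by (metis add.assoc image_mset_union)
      also have "\<dots> = sym A + sym B"
        by (simp add: sym_def B_def add_ac)
      finally have sum: "sym A + sym B = T + T" using \<open>sym T = T + T\<close> by simp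
      have "real (count (sym A) x) = real (count T x)" if "x \<in> X" for x
        using \<open>finite X\<close> _ _ _ that
      proof (rule midpoint_of_ball_unique[where b = "\<lambda>x. real (count (sym B) x)"])
        show "real (count (sym A) x) + real (count (sym B) x) = 2 * real (count T x)" for x
          using arg_cong[OF sum, of "\<lambda>M. real (count M x)"] by simp
      qed (use max[OF \<open>A \<in> S\<close>] max[OF \<open>B \<in> S\<close>] in \<open>auto simp: h_def T_def\<close>)
      moreover have "count (sym A) x = count T x" if "x \<notin> X" for x
        using that \<open>A \<in> S\<close> M0 by (auto simp: X_def T_def not_in_iff)
      ultimately have "count (sym A) x = count T x" for x
        by (cases "x \<in> X") auto
      then have "sym A = T" by (simp add: multiset_eq_iff)
      then have "T - A = image_mset conj_coord A" by (auto simp: sym_def)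
      with False show False ..
    qed
    moreover have "p j k0 (T - A) = cnj (p k0 j B)"
      using star[OF j k0, of "T - A"] by (simp add: B_def)
    ultimately show ?thesis using False by auto
  qed
  have "p k0 k0 T = of_real (\<Sum>j<n. \<Sum>A | A \<subseteq># T. ?r j A)"
    unfolding idem[OF k0 k0] twisted_conv_def of_real_sum
    by (intro sum.cong refl summand) auto
  then have "of_real (\<Sum>j<n. \<Sum>A | A \<subseteq># T. ?r j A) = p k0 k0 T" by simp
  also have "\<dots> = 0" using \<open>T \<notin> S\<close> k0 by (auto simp: S_def)
  finally have "(\<Sum>j<n. \<Sum>A | A \<subseteq># T. ?r j A) = 0"
    by (simp only: of_real_eq_0_iff)
  then have "(\<Sum>A | A \<subseteq># T. ?r l0 A) = 0"
    using l0 by (subst (asm) sum_nonneg_eq_0_iff) (auto intro!: sum_nonneg)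
  moreover have "M0 \<subseteq># T" by (simp add: T_def sym_def)
  ultimately have "?r l0 M0 = 0"
    by (subst (asm) sum_nonneg_eq_0_iff) (auto simp: finite_subset_mset)
  with p0 show False by (simp add: T_def sym_def)
qed

section \<open>Cosets\<close>

definition cls :: "'n free \<Rightarrow> 'n free set" where
  "cls f = rel_ideal +>\<^bsub>free_alg\<^esub> f"

lemma cls_eq: "cls f = {h. h - f \<in> rel_ideal}"
proof -
  have "h \<in> cls f" if "h - f \<in> rel_ideal" for h
    using that by (auto simp: cls_def a_r_coset_def' free_alg_def intro!: bexI[of _ "h - f"])
  then show ?thesis
    by (auto simp: cls_def a_r_coset_def' free_alg_def)
qed

lemma in_cls_iff: "h \<in> cls f \<longleftrightarrow> h - f \<in> rel_ideal"
  by (simp add: cls_eq)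

lemma cls_eq_iff: "cls f = cls g \<longleftrightarrow> f - g \<in> rel_ideal"
proof
  assume "cls f = cls g"
  then show "f - g \<in> rel_ideal"
    using in_cls_iff[of f f] in_cls_iff[of f g] by (simp add: rel_ideal_zero)
next
  assume fg: "f - g \<in> rel_ideal"
  then have "g - f \<in> rel_ideal" using rel_ideal_uminus[OF fg] by simp
  with fg show "cls f = cls g"
    unfolding cls_eq by (auto intro: rel_ideal_trans)
qed

lemma C_alg_quot: "C_alg \<Theta> = star_quot free_alg rel_ideal"
  by (simp add: C_alg_def rel_ideal_def)

lemma carrier_C_alg: "carrier (C_alg \<Theta>) = range cls"
proof -
  have "carrier (free_alg :: 'n free star_algebra) = UNIV" by (simp add: free_alg_def)
  then show ?thesis
    by (auto simp: C_alg_quot star_quot_def FactRing_def A_RCOSETS_def' cls_def)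
qed

lemma mult_C_alg: "cls f \<otimes>\<^bsub>C_alg \<Theta>\<^esub> cls g = cls (f * g)"
  using ideal.rcoset_mult_add[OF rel_ideal_ideal, of f g]
  by (simp add: C_alg_quot star_quot_def FactRing_def cls_def) (simp add: free_alg_def)

lemma add_C_alg: "cls f \<oplus>\<^bsub>C_alg \<Theta>\<^esub> cls g = cls (f + g)"
  using abelian_subgroup.a_rcos_sum[OF abelian_subgroupI3, of rel_ideal free_alg f g]
    ideal.axioms(1)[OF rel_ideal_ideal] ring.is_abelian_group[OF free_alg_ring]
  by (simp add: C_alg_quot star_quot_def FactRing_def cls_def) (simp add: free_alg_def)

lemma zero_C_alg: "\<zero>\<^bsub>C_alg \<Theta>\<^esub> = cls 0"
  by (simp add: C_alg_quot star_quot_def FactRing_def cls_eq)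

lemma one_C_alg: "\<one>\<^bsub>C_alg \<Theta>\<^esub> = cls 1"
  by (simp add: C_alg_quot star_quot_def FactRing_def cls_def) (simp add: free_alg_def)

lemma star_C_alg: "star (C_alg \<Theta>) X = free_star ` X"
  by (simp add: C_alg_quot star_quot_def free_alg_def)

text \<open>
  The scalar multiple of a coset is by definition enlarged by the ideal, so it is a full coset also for
  \<open>c = 0\<close>.
\<close>

lemma scalar_C_alg: "c \<odot>\<^bsub>C_alg \<Theta>\<^esub> \<one>\<^bsub>C_alg \<Theta>\<^esub> = cls (monom_word [] c)"
proof -
  let ?c = "monom_word [] c"
  have "c \<odot>\<^bsub>C_alg \<Theta>\<^esub> \<one>\<^bsub>C_alg \<Theta>\<^esub> = {i + ?c * h | i h. i \<in> rel_ideal \<and> h - 1 \<in> rel_ideal}"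
    unfolding one_C_alg cls_eq
    by (auto simp: C_alg_quot star_quot_def set_add_def' free_alg_def)
  also have "\<dots> = {h. h - ?c \<in> rel_ideal}"
  proof (intro equalityI subsetI)
    fix x assume "x \<in> {i + ?c * h | i h. i \<in> rel_ideal \<and> h - 1 \<in> rel_ideal}"
    then obtain i h where x: "x = i + ?c * h" and "i \<in> rel_ideal" "h - 1 \<in> rel_ideal" by blast
    then have "i + ?c * (h - 1) \<in> rel_ideal" by (intro rel_ideal_add rel_ideal_mult_left)
    then show "x \<in> {h. h - ?c \<in> rel_ideal}" by (simp add: x right_diff_distrib add_diff_eq)
  next
    fix x assume "x \<in> {h. h - ?c \<in> rel_ideal}"
    then have "x = (x - ?c) + ?c * 1 \<and> x - ?c \<in> rel_ideal \<and> 1 - 1 \<in> rel_ideal"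
      by (simp add: rel_ideal_zero)
    then show "x \<in> {i + ?c * h | i h. i \<in> rel_ideal \<and> h - 1 \<in> rel_ideal}"
      by blast
  qed
  finally show ?thesis by (simp add: cls_eq)
qed

end

text \<open>
  A finite sum in a structure depends on the carrier as a whole.  This lemma evaluates it both in the
  quotient and in its scalar subalgebra, whose addition is the same.
\<close>

lemma finsum_additive_image:
  fixes A (structure) and h :: "'b::ab_group_add \<Rightarrow> 'a"
  assumes "carrier A = range h" and zero: "\<zero> = h 0" and add: "\<And>x y. h x \<oplus> h y = h (x + y)"
    and "finite S" and "\<And>j. j \<in> S \<Longrightarrow> g j = h (f j)"
  shows "(\<Oplus>j\<in>S. g j) = h (\<Sum>j\<in>S. f j)"
proof -
  interpret abelian_monoid A
    by (rule abelian_monoidI) (auto simp: assms(1) zero add add_ac)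
  show ?thesis
    using assms(4,5)
  proof (induction S)
    case (insert j S)
    then have "(\<Oplus>i\<in>insert j S. g i) = g j \<oplus> (\<Oplus>i\<in>S. g i)"
      by (intro finsum_insert) (auto simp: assms(1))
    with insert show ?case by (simp add: add)
  qed (simp add: zero)
qed

section \<open>Projectors\<close>

theorem proposition2p2:
  fixes \<Theta> :: "'n::finite \<Rightarrow> 'n \<Rightarrow> real" and P :: "'n free set mat"
  assumes skew: "\<And>p q. \<Theta> p q = - \<Theta> q p"
    and proj: "P \<in> projectors (C_alg \<Theta>)"
  shows "P \<in> projectors (scalar_subalgebra (C_alg \<Theta>))"
proof -
  interpret skew_form \<Theta> by unfold_locales (rule skew)
  let ?A = "C_alg \<Theta>" and ?B = "scalar_subalgebra (C_alg \<Theta>)"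
  define n where "n = dim_row P"
  have dim: "dim_row P = n" "dim_col P = n"
    and idem: "mat_prod ?A P P = P" and star: "mat_star ?A P = P"
    and entries: "elements_mat P \<subseteq> range cls"
    using proj by (auto simp: projectors_def n_def carrier_C_alg)
  have finsum_A: "(\<Oplus>\<^bsub>?A\<^esub>j\<in>{..<n}. X j) = cls (\<Sum>j<n. g j)"
    if "\<And>j. j < n \<Longrightarrow> X j = cls (g j)" for X g
    by (rule finsum_additive_image) (simp_all add: carrier_C_alg zero_C_alg add_C_alg that)
  have rep: "\<exists>f. P $$ (k, l) = cls f" if "k < n" "l < n" for k l
  proof -
    have "P $$ (k, l) \<in> elements_mat P"
      using that dim by (intro elements_matI[of P n n k l]) auto
    with entries show ?thesis by blast
  qed
  define f where "f k l = (SOME g. P $$ (k, l) = cls g)" for k l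
  have f: "P $$ (k, l) = cls (f k l)" if "k < n" "l < n" for k l
    unfolding f_def by (rule someI_ex[OF rep[OF that]])
  have f_star: "free_star (f l k) - f k l \<in> rel_ideal" if "k < n" "l < n" for k l
  proof -
    \<comment> \<open>The involution of a coset is its image, so the conjugate of a representative lies in it.\<close>
    have "free_star (f l k) \<in> star ?A (P $$ (l, k))"
      using f[of l k] that by (auto simp: star_C_alg in_cls_iff rel_ideal_zero)
    also have "\<dots> = P $$ (k, l)"
      using arg_cong[OF star, of "\<lambda>Q. Q $$ (k, l)"] that dim by (simp add: mat_star_def)
    finally show ?thesis using f that by (simp add: in_cls_iff)
  qed
  have f_idem: "(\<Sum>j<n. f k j * f j l) - f k l \<in> rel_ideal" if "k < n" "l < n" for k l
  proof -
    have "P $$ (k, l) = (\<Oplus>\<^bsub>?A\<^esub>j\<in>{..<n}. P $$ (k, j) \<otimes>\<^bsub>?A\<^esub> P $$ (j, l))"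
      using arg_cong[OF idem, of "\<lambda>Q. Q $$ (k, l)"] that dim by (simp add: mat_prod_def)
    also have "\<dots> = cls (\<Sum>j<n. f k j * f j l)"
      using that by (intro finsum_A) (simp add: f mult_C_alg)
    finally show ?thesis using f that by (simp add: cls_eq_iff[symmetric])
  qed
  have "coef M (f k l) = 0" if "k < n" "l < n" "M \<noteq> {#}" for k l M
  proof (rule twisted_projector_scalar[where p = "\<lambda>k l M. coef M (f k l)", OF _ _ _ that])
    show "finite {M. coef M (f k l) \<noteq> 0}" for k l
    proof (rule finite_subset)
      show "{M. coef M (f k l) \<noteq> 0} \<subseteq> mset ` Poly_Mapping.keys (f k l)"
        by (auto simp: coef_def word_weight_def intro!: sum.neutral)
    qed simp
    show "coef M (f k l) = cnj (coef (image_mset conj_coord M) (f l k))" if "k < n" "l < n" for k l M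
      using coef_rel_ideal[OF f_star[OF that], of M] by (simp add: coef_diff coef_free_star)
    show "coef M (f k l) = (\<Sum>j<n. twisted_conv (\<lambda>M. coef M (f k j)) (\<lambda>M. coef M (f j l)) M)"
      if "k < n" "l < n" for k l M
      using coef_rel_ideal[OF f_idem[OF that], of M] by (simp add: coef_diff coef_sum coef_mult)
  qed
  then have scalar: "P $$ (k, l) = cls (monom_word [] (coef {#} (f k l)))" if "k < n" "l < n" for k l
    unfolding f[OF that] cls_eq_iff using that by (intro scalar_if_coef_zero)
  let ?c = "\<lambda>k l. coef {#} (f k l)" and ?s = "\<lambda>c. cls (monom_word [] c)"
  have carrier_B: "carrier ?B = range ?s"
    by (auto simp: scalar_subalgebra_def scalar_C_alg)
  have finsum_B: "(\<Oplus>\<^bsub>?B\<^esub>j\<in>{..<n}. X j) = ?s (\<Sum>j<n. g j)"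
    if "\<And>j. j < n \<Longrightarrow> X j = ?s (g j)" for X g
    by (rule finsum_additive_image[where h = ?s, OF carrier_B])
      (simp_all add: scalar_subalgebra_def zero_C_alg add_C_alg single_add that)
  have sum_single: "monom_word [] (\<Sum>j<n. g j) = (\<Sum>j<n. monom_word [] (g j) :: 'n free)" for g
    by (induction n) (simp_all add: single_add)
  \<comment> \<open>The two matrix products have the same summands but are sums over different carriers.\<close>
  have "(\<Oplus>\<^bsub>?B\<^esub>j\<in>{..<n}. P $$ (k, j) \<otimes>\<^bsub>?B\<^esub> P $$ (j, l))
      = (\<Oplus>\<^bsub>?A\<^esub>j\<in>{..<n}. P $$ (k, j) \<otimes>\<^bsub>?A\<^esub> P $$ (j, l))" if "k < n" "l < n" for k l
  proof -
    have prod: "P $$ (k, j) \<otimes>\<^bsub>?A\<^esub> P $$ (j, l) = ?s (?c k j * ?c j l)" if "j < n" for j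
      using \<open>k < n\<close> \<open>l < n\<close> that by (simp add: scalar mult_C_alg mult_single plus_list_def)
    then have "(\<Oplus>\<^bsub>?B\<^esub>j\<in>{..<n}. P $$ (k, j) \<otimes>\<^bsub>?B\<^esub> P $$ (j, l)) = ?s (\<Sum>j<n. ?c k j * ?c j l)"
      by (intro finsum_B) (simp add: scalar_subalgebra_def)
    also have "\<dots> = (\<Oplus>\<^bsub>?A\<^esub>j\<in>{..<n}. P $$ (k, j) \<otimes>\<^bsub>?A\<^esub> P $$ (j, l))"
      unfolding sum_single using prod by (intro finsum_A[symmetric]) auto
    finally show ?thesis .
  qed
  then have "mat_prod ?B P P = mat_prod ?A P P"
    unfolding mat_prod_def dim by (intro eq_matI) auto
  moreover have "mat_star ?B P = mat_star ?A P"
    by (simp add: mat_star_def scalar_subalgebra_def)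
  moreover have "elements_mat P \<subseteq> carrier ?B"
    using scalar dim unfolding carrier_B by auto
  ultimately show ?thesis
    using idem star dim by (simp add: projectors_def)
qed

end
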